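(* Let $\gamma,\eta,\lambda\in\mathbb{R}$, $a\in\mathbb{C}$, $k\in\mathbb{Z}$, $m\in\mathbb{N}$ and $n\in\mathbb{N}_0$. Then the generalized Apostol-Bernoulli poly-Daehee polynomials satisfy $${}_{\mathfrak{B}}\mathfrak{D}_{n,a}^{[k,m-1]}(\gamma,\eta;\lambda)=\frac{{}_{\mathfrak{B}}\mathfrak{D}_{n+1,a}^{[k,m-1]}(\gamma+1,\eta;\lambda)-{}_{\mathfrak{B}}\mathfrak{D}_{n+1,a}^{[k,m-1]}(\gamma,\eta;\lambda)}{n+1}.$$
   Context: $\mathbb{N}=\{1,2,\dots\}$, $\mathbb{N}_0=\mathbb{N}\cup\{0\}$. The polylogarithm is $\mathrm{Li}_k(z)=\sum_{r=1}^{\infty} z^r/r^k$. Generalized Apostol-Bernoulli poly-Daehee polynomials (GABPDP), defined by the generating function $$(1+x)^{\gamma}\,\frac{\log(1+x)}{\mathrm{Li}_k(1-e^{-x})}\,e^{\eta x}\left(\frac{x^m}{\lambda e^x-\sum_{l=0}^{m-1}\frac{x^l}{l!}}\right)^{a}=\sum_{n=0}^\infty {}_{\mathfrak{B}}\mathfrak{D}_{n,a}^{[k,m-1]}(\gamma,\eta;\lambda)\frac{x^n}{n!}.$$ *)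

theory Defs
  imports "HOL-Analysis.Analysis"
begin

unbundle no vec_syntax
unbundle fps_syntax

text \<open>
  Generating functions are formal power series over the complex numbers in the indeterminate
  \<open>x\<close> = \<^const>\<open>fps_X\<close>.  Thus \<open>(1+x)\<close> to the power \<open>\<gamma>\<close> is
  \<open>fps_binomial \<gamma>\<close>, \<open>log(1+x)\<close> is \<open>fps_ln 1\<close> and \<open>e\<close> to the power
  \<open>\<eta> x\<close> is \<open>fps_exp \<eta>\<close>.
\<close>

definition fps_polylog :: "int \<Rightarrow> complex fps" where
  "fps_polylog k = Abs_fps (\<lambda>r. if r = 0 then 0 else 1 / of_nat r powi k)"

text \<open>
  Complex powers.  Write \<open>f = x\<^sup>d g\<close> with \<open>g(0) = c \<noteq> 0\<close> and read
  \<open>f\<close> to the power \<open>a\<close> as \<open>x\<close> to the power \<open>d a\<close> times the binomial series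
  \<open>c\<^sup>a (1 + (g/c - 1))\<^sup>a\<close>, with the principal branch of \<open>c\<^sup>a\<close>.  This is a power series
  precisely when \<open>d a\<close> is a non-negative integer.  That always holds if \<open>d = 0\<close> or if
  \<open>a\<close> is a non-negative integer, and in the latter case one gets the ordinary power (see
  below).  Otherwise \<open>f\<close> to the power \<open>a\<close> has no expansion in non-negative integer powers
  of \<open>x\<close>, and the value is left unspecified.
\<close>

definition fps_unit_cpow :: "complex fps \<Rightarrow> complex \<Rightarrow> complex fps" where
  "fps_unit_cpow g a =
     fps_const ((g $ 0) powr a) * (fps_binomial a oo (fps_const (1 / g $ 0) * g - 1))"

definition fps_cpow :: "complex fps \<Rightarrow> complex \<Rightarrow> complex fps" where
  "fps_cpow f a =
     (let d = subdegree f in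
      if of_nat d * a \<in> \<nat>
      then fps_X ^ (THE N. of_nat d * a = of_nat N) * fps_unit_cpow (fps_shift d f) a
      else undefined)"

definition apostol_denom :: "nat \<Rightarrow> real \<Rightarrow> complex fps" where
  "apostol_denom m lam =
     fps_const (of_real lam) * fps_exp 1 - (\<Sum>l<m. fps_const (1 / fact l) * fps_X ^ l)"

text \<open>
  The two divisions are exact in the ring of power series (see below).  The argument
  \<open>m\<close> corresponds to the superscript \<open>m - 1\<close> of the usual notation.
\<close>

definition GABPDP_gf :: "int \<Rightarrow> nat \<Rightarrow> complex \<Rightarrow> real \<Rightarrow> real \<Rightarrow> real \<Rightarrow> complex fps" where
  "GABPDP_gf k m a \<gamma> \<eta> lam =
     fps_binomial (of_real \<gamma>) * (fps_ln 1 / (fps_polylog k oo (1 - fps_exp (-1))))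
       * fps_exp (of_real \<eta>) * fps_cpow (fps_X ^ m / apostol_denom m lam) a"

definition GABPDP :: "int \<Rightarrow> nat \<Rightarrow> complex \<Rightarrow> real \<Rightarrow> real \<Rightarrow> real \<Rightarrow> nat \<Rightarrow> complex" where
  "GABPDP k m a \<gamma> \<eta> lam n = fact n * GABPDP_gf k m a \<gamma> \<eta> lam $ n"

lemma GABPDP_egf: "Abs_fps (\<lambda>n. GABPDP k m a \<gamma> \<eta> lam n / fact n) = GABPDP_gf k m a \<gamma> \<eta> lam"
  by (rule fps_ext) (simp add: GABPDP_def)

lemma log_polylog_quotient_exact:
  "(fps_ln 1 / (fps_polylog k oo (1 - fps_exp (-1)))) * (fps_polylog k oo (1 - fps_exp (-1)))
     = fps_ln 1"
proof -
  let ?L = "fps_polylog k oo (1 - fps_exp (-1))"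
  have L1: "?L $ 1 = 1" by (simp add: fps_compose_nth fps_polylog_def)
  have "?L \<noteq> 0" using L1 by (metis fps_zero_nth zero_neq_one)
  moreover have "fps_ln (1::complex) \<noteq> 0"
    by (auto simp: fps_eq_iff fps_ln_nth intro!: exI[of _ 1])
  moreover have "subdegree ?L \<le> 1" by (rule subdegree_leI) (use L1 in simp)
  moreover have "1 \<le> subdegree (fps_ln (1::complex))"
    using \<open>fps_ln (1::complex) \<noteq> 0\<close> by (intro subdegree_geI) auto
  ultimately have "?L dvd fps_ln 1" by (subst fps_dvd_iff) auto
  then show ?thesis by simp
qed

lemma apostol_denom_nth:
  "apostol_denom m lam $ n = (of_real lam - (if n < m then 1 else 0)) / fact n"
  by (auto simp: apostol_denom_def fps_sum_nth diff_divide_distrib if_distrib cong: if_cong)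

lemma apostol_quotient_exact:
  "(fps_X ^ m / apostol_denom m lam) * apostol_denom m lam = fps_X ^ m"
  if "m \<ge> 1"
proof -
  have "\<exists>n\<le>m. apostol_denom m lam $ n \<noteq> 0"
  proof (cases "lam = 1")
    case True
    then show ?thesis by (auto simp: apostol_denom_nth)
  next
    case False
    then show ?thesis using that by (auto simp: apostol_denom_nth intro!: exI[of _ 0])
  qed
  then obtain n where n: "n \<le> m" "apostol_denom m lam $ n \<noteq> 0" by blast
  then have "apostol_denom m lam \<noteq> 0" by auto
  moreover have "subdegree (apostol_denom m lam) \<le> m"
    using n by (meson le_trans subdegree_leI)
  ultimately have "apostol_denom m lam dvd fps_X ^ m" by (subst fps_dvd_iff) auto
  then show ?thesis by simp
qed

lemma fps_unit_cpow_add: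
  assumes "g $ 0 \<noteq> 0"
  shows "fps_unit_cpow g (a + b) = fps_unit_cpow g a * fps_unit_cpow g b"
proof -
  let ?h = "fps_const (1 / g $ 0) * g - 1"
  have "fps_binomial (a + b) oo ?h = (fps_binomial a oo ?h) * (fps_binomial b oo ?h)"
    unfolding fps_binomial_add_mult using assms by (intro fps_compose_mult_distrib) simp
  then show ?thesis
    by (simp add: fps_unit_cpow_def powr_add mult_ac flip: fps_const_mult)
qed

lemma fps_cpow_of_nat:
  assumes "f \<noteq> 0"
  shows "fps_cpow f (of_nat j) = f ^ j"
proof -
  define d where "d = subdegree f"
  define g where "g = fps_shift d f"
  have f: "f = g * fps_X ^ d" unfolding g_def d_def by (rule subdegree_decompose)
  have g0: "g $ 0 \<noteq> 0" using assms by (simp add: g_def d_def)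
  have N: "(THE N. of_nat d * of_nat j = (of_nat N :: complex)) = d * j"
    by (rule the_equality) (simp_all flip: of_nat_mult)
  have "fps_unit_cpow g (of_nat j)
      = fps_const (g $ 0) ^ j * ((1 + fps_X) oo (fps_const (1 / g $ 0) * g - 1)) ^ j"
    using g0 by (simp add: fps_unit_cpow_def fps_binomial_of_nat fps_compose_power
        powr_nat fps_const_power)
  also have "\<dots> = (fps_const (g $ 0) * (fps_const (1 / g $ 0) * g)) ^ j"
    using g0 by (simp add: power_mult_distrib fps_compose_add_distrib)
  also have "fps_const (g $ 0) * (fps_const (1 / g $ 0) * g) = g"
    using g0 by (simp flip: mult.assoc)
  finally have "fps_unit_cpow g (of_nat j) = g ^ j" .
  moreover have "(of_nat d * of_nat j :: complex) \<in> \<nat>" by (simp flip: of_nat_mult)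
  ultimately have "fps_cpow f (of_nat j) = fps_X ^ (d * j) * g ^ j"
    using N by (simp add: fps_cpow_def Let_def d_def g_def)
  also have "\<dots> = f ^ j" using f by (simp add: power_mult_distrib power_mult mult.commute)
  finally show ?thesis .
qed

end

theory Submission
  imports Defs
begin

text \<open>The parameter \<open>\<gamma>\<close> enters only through the factor
  (1+x)^\<open>\<gamma>\<close>, so raising it by 1 multiplies the generating function F by 1+x,
  whatever the other factors are. The difference of the two series is thus x F, and comparing
  coefficients of x^(n+1) gives the recurrence.\<close>

lemma GABPDP_gf_Suc_gamma:
  "GABPDP_gf k m a (\<gamma> + 1) \<eta> lam = (1 + fps_X) * GABPDP_gf k m a \<gamma> \<eta> lam"
  by (simp add: GABPDP_gf_def fps_binomial_add_mult fps_binomial_1 mult_ac)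

theorem theorem2p2:
  fixes \<gamma> \<eta> lam :: real and a :: complex and k :: int and m n :: nat
  assumes "m \<ge> 1"
  shows "GABPDP k m a \<gamma> \<eta> lam n =
    (GABPDP k m a (\<gamma> + 1) \<eta> lam (n + 1) - GABPDP k m a \<gamma> \<eta> lam (n + 1)) / of_nat (n + 1)"
proof -
  have "GABPDP_gf k m a (\<gamma> + 1) \<eta> lam $ (n + 1) - GABPDP_gf k m a \<gamma> \<eta> lam $ (n + 1)
      = GABPDP_gf k m a \<gamma> \<eta> lam $ n"
    by (simp add: GABPDP_gf_Suc_gamma distrib_right)
  \<comment> \<open>The factor \<open>n + 1\<close> is (n+1)!/n!, from the exponential normalization
    in \<open>GABPDP_def\<close>.\<close>
  then have "GABPDP k m a (\<gamma> + 1) \<eta> lam (n + 1) - GABPDP k m a \<gamma> \<eta> lam (n + 1)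
      = of_nat (n + 1) * GABPDP k m a \<gamma> \<eta> lam n"
    unfolding GABPDP_def by (simp flip: right_diff_distrib)
  then show ?thesis
    by (simp del: of_nat_Suc of_nat_add)
qed

end
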